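(* Let $F=(F_1,\ldots,F_k)$ be a tuple of polynomial maps $F_i:\mathbb{C}^n\to\mathbb{C}^n$, let $h\in\mathbb{C}[x_1,\ldots,x_n]$ be a non-zero polynomial, and consider the branching loops $\mathcal{L}(\mathbf{a},h,F)$ for $\mathbf{a}\in\mathbb{C}^n$. Let $f\in\mathbb{C}[x_1,\ldots,x_n]$. Then $f(\mathbf{x})-f(\mathbf{a})\in I_{\mathcal{L}(\mathbf{a},h,F)}$ for every $\mathbf{a}\in\mathbb{C}^n$ if and only if $f(F_i(\mathbf{x}))=f(\mathbf{x})$ (as polynomials) for every $i\in\{1,\ldots,k\}$.
   Context: Notation: $\mathbf{x}=(x_1,\ldots,x_n)$, $[k]=\{1,\ldots,k\}$. For $i_1,\ldots,i_m\in[k]$, $F_{i_1,\ldots,i_m}=F_{i_m}\circ\cdots\circ F_{i_1}$, with the empty composition equal to the identity. Branching loop: $\mathcal{L}(\mathbf{a},h,(F_1,\ldots,F_k))$ is the loop which initializes $\mathbf{x}=\mathbf{a}$ and, while $h(\mathbf{x})\neq0$, nondeterministically chooses $i\in[k]$ and performs $\mathbf{x}\leftarrow F_i(\mathbf{x})$. A polynomial $g\in\mathbb{C}[\mathbf{x}]$ is a polynomial invariant of the loop if $g(\mathbf{a})=0$ and, for every $m\in\mathbb{N}$ and every $i_1,\ldots,i_m\in[k]$, either $g(F_{i_1}(\mathbf{a}))=\cdots=g(F_{i_1,\ldots,i_m}(\mathbf{a}))=0$, or there is $0\le l<m$ such that $g(F_{i_1}(\mathbf{a}))=\cdots=g(F_{i_1,\ldots,i_l}(\mathbf{a}))=0$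 and $h(F_{i_1,\ldots,i_l}(\mathbf{a}))=0$. $I_{\mathcal{L}(\mathbf{a},h,F)}$ is the set of all polynomial invariants of the loop. *)

theory Defs
  imports "HOL-Analysis.Finite_Cartesian_Product" "HOL-Library.Poly_Mapping"
begin

text \<open>
  The polynomial ring \<open>\<complex>[x\<^sub>1,\<dots>,x\<^sub>n]\<close>, with the variables indexed by a finite type \<open>'n\<close> of
  cardinality \<open>n\<close>: a polynomial maps each exponent vector, with finite support, to its coefficient.
  The ring structure is that of \<open>Poly_Mapping\<close>, whose product is the convolution product.
\<close>

type_synonym 'n cpoly = "('n \<Rightarrow>\<^sub>0 nat) \<Rightarrow>\<^sub>0 complex"

definition Const :: "complex \<Rightarrow> 'n cpoly" where
  "Const c = Poly_Mapping.single 0 c"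

definition eval :: "'n::finite cpoly \<Rightarrow> complex ^ 'n \<Rightarrow> complex" where
  "eval p a = (\<Sum>m\<in>Poly_Mapping.keys p.
     Poly_Mapping.lookup p m * (\<Prod>j\<in>UNIV. (a $ j) ^ Poly_Mapping.lookup m j))"

text \<open>
  A polynomial map \<open>\<complex>\<^sup>n \<rightarrow> \<complex>\<^sup>n\<close> is given by the vector \<open>G\<close> of its coordinate polynomials. The map
  itself is \<open>poly_map G\<close>, and \<open>subst p G\<close> is the polynomial \<open>p(G(\<^bold>x))\<close>.
\<close>

definition poly_map :: "'n::finite cpoly ^ 'n \<Rightarrow> complex ^ 'n \<Rightarrow> complex ^ 'n" where
  "poly_map G a = (\<chi> j. eval (G $ j) a)"

definition subst :: "'n::finite cpoly \<Rightarrow> 'n cpoly ^ 'n \<Rightarrow> 'n cpoly" where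
  "subst p G = (\<Sum>m\<in>Poly_Mapping.keys p.
     Const (Poly_Mapping.lookup p m) * (\<Prod>j\<in>UNIV. (G $ j) ^ Poly_Mapping.lookup m j))"

text \<open>
  \<open>comp_word F [i\<^sub>1,\<dots>,i\<^sub>m] = F\<^bsub>i\<^sub>m\<^esub> \<circ> \<dots> \<circ> F\<^bsub>i\<^sub>1\<^esub>\<close>: the head of the word is applied first.
\<close>

definition comp_word ::
  "(nat \<Rightarrow> 'n::finite cpoly ^ 'n) \<Rightarrow> nat list \<Rightarrow> complex ^ 'n \<Rightarrow> complex ^ 'n" where
  "comp_word F w = fold (\<lambda>i G. poly_map (F i) \<circ> G) w id"

text \<open>
  The set of polynomial invariants of the branching loop \<open>\<L>(a, h, (F 1, \<dots>, F k))\<close>. The word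
  \<open>w\<close> is \<open>[i\<^sub>1,\<dots>,i\<^sub>m]\<close>, so that \<open>take j w\<close> is \<open>[i\<^sub>1,\<dots>,i\<^sub>j]\<close>; only \<open>F 1, \<dots>, F k\<close> matter.
\<close>

definition loop_invariants ::
  "complex ^ 'n \<Rightarrow> 'n::finite cpoly \<Rightarrow> nat \<Rightarrow> (nat \<Rightarrow> 'n cpoly ^ 'n) \<Rightarrow> 'n cpoly set" where
  "loop_invariants a h k F = {g. eval g a = 0 \<and>
     (\<forall>w. set w \<subseteq> {1..k} \<longrightarrow>
        (\<forall>j\<in>{1..length w}. eval g (comp_word F (take j w) a) = 0) \<or>
        (\<exists>l<length w. (\<forall>j\<in>{1..l}. eval g (comp_word F (take j w) a) = 0) \<and>
           eval h (comp_word F (take l w) a) = 0))}"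

end

theory Submission
  imports Defs "HOL-Computational_Algebra.Polynomial"
begin

text \<open>
  If \<open>f \<circ> F\<^sub>i = f\<close> for all \<open>i\<close>, then \<open>f\<close> is constant on every orbit. Conversely, the words of length
  one give \<open>h(a) (f(F\<^sub>i(a)) - f(a)) = 0\<close> for all \<open>a\<close>. Two nonzero polynomials have a common
  non-root: Kronecker's substitution \<open>x\<^sub>j = t ^ (N ^ j)\<close>, for \<open>N\<close> above all exponents, turns them into
  nonzero polynomials in \<open>t\<close>. Hence \<open>h \<noteq> 0\<close> forces \<open>f \<circ> F\<^sub>i - f = 0\<close>.
\<close>

definition eval_monom :: "('n::finite \<Rightarrow>\<^sub>0 nat) \<Rightarrow> complex ^ 'n \<Rightarrow> complex" where
  "eval_monom m a = (\<Prod>j\<in>UNIV. (a $ j) ^ Poly_Mapping.lookup m j)"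

text \<open>Coefficients vanish off the support, so polynomials with different supports can be
  evaluated over one common index set.\<close>

lemma eval_eq_sum_superset:
  assumes "finite A" "Poly_Mapping.keys p \<subseteq> A"
  shows "eval p a = (\<Sum>m\<in>A. Poly_Mapping.lookup p m * eval_monom m a)"
  unfolding eval_def eval_monom_def
  using assms by (intro sum.mono_neutral_left) (auto simp: in_keys_iff)

lemma eval_0 [simp]: "eval 0 a = 0"
  by (simp add: eval_def)

lemma eval_add: "eval (p + q) a = eval p a + eval q a"
proof -
  let ?A = "Poly_Mapping.keys p \<union> Poly_Mapping.keys q"
  have "Poly_Mapping.keys (p + q) \<subseteq> ?A"
    by (rule keys_add)
  then show ?thesis
    by (simp add: eval_eq_sum_superset[of ?A] lookup_add distrib_right sum.distrib)
qed

lemma eval_diff: "eval (p - q) a = eval p a - eval q a"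
  using eval_add[of "p - q" q a] by simp

lemma eval_sum: "eval (sum p A) a = (\<Sum>i\<in>A. eval (p i) a)"
  by (induction A rule: infinite_finite_induct) (auto simp: eval_add)

lemma eval_single: "eval (Poly_Mapping.single m c) a = c * eval_monom m a"
  by (subst eval_eq_sum_superset[of "{m}"]) auto

lemma eval_monom_add: "eval_monom (m + m') a = eval_monom m a * eval_monom m' a"
  by (simp add: eval_monom_def lookup_add power_add prod.distrib)

lemma eval_Const [simp]: "eval (Const c) a = c"
  by (simp add: Const_def eval_single eval_monom_def)

text \<open>Both factors are expanded into monomials; by bilinearity the claim reduces to
  \<open>eval_monom_add\<close>.\<close>

lemma eval_mult: "eval (p * q) a = eval p a * eval q a"
proof -
  have expand: "r = (\<Sum>m\<in>Poly_Mapping.keys r. Poly_Mapping.single m (Poly_Mapping.lookup r m))"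
    for r :: "'a cpoly"
    by (rule poly_mapping_eqI)
      (auto simp: lookup_sum lookup_single when_def in_keys_iff sum.delta')
  have "p * q = (\<Sum>m\<in>Poly_Mapping.keys p. Poly_Mapping.single m (Poly_Mapping.lookup p m)) *
      (\<Sum>m\<in>Poly_Mapping.keys q. Poly_Mapping.single m (Poly_Mapping.lookup q m))"
    using expand[of p] expand[of q] by (rule arg_cong2)
  also have "\<dots> = (\<Sum>m\<in>Poly_Mapping.keys p. \<Sum>m'\<in>Poly_Mapping.keys q.
      Poly_Mapping.single (m + m') (Poly_Mapping.lookup p m * Poly_Mapping.lookup q m'))"
    by (simp add: sum_product mult_single)
  finally have "eval (p * q) a = (\<Sum>m\<in>Poly_Mapping.keys p. \<Sum>m'\<in>Poly_Mapping.keys q.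
      (Poly_Mapping.lookup p m * eval_monom m a) * (Poly_Mapping.lookup q m' * eval_monom m' a))"
    by (simp add: eval_sum eval_single eval_monom_add mult_ac)
  then show ?thesis
    by (simp only: sum_product eval_eq_sum_superset[OF finite_keys order_refl])
qed

lemma eval_1 [simp]: "eval 1 a = 1"
  using eval_Const[of 1 a] by (simp add: Const_def)

lemma eval_power: "eval (p ^ e) a = eval p a ^ e"
  by (induction e) (auto simp: eval_mult)

lemma eval_prod: "eval (prod p A) a = (\<Prod>i\<in>A. eval (p i) a)"
  by (induction A rule: infinite_finite_induct)
    (auto simp: eval_mult)

text \<open>The bridge between the polynomial identity \<open>subst f (F i) = f\<close> and the
  values of \<open>f\<close> along the loop.\<close>

lemma eval_subst: "eval (subst p G) a = eval p (poly_map G a)"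
  by (simp add: subst_def eval_sum eval_mult eval_prod eval_power poly_map_def eval_def[of p])

text \<open>Uniqueness of base-\<open>N\<close> digits: reduction mod \<open>N\<close> isolates the
  lowest digit, division by \<open>N\<close> leaves the remaining ones for the induction.\<close>

lemma digits_unique:
  fixes d e :: "nat \<Rightarrow> nat"
  assumes "\<And>i. i < n \<Longrightarrow> d i < N" "\<And>i. i < n \<Longrightarrow> e i < N"
    and "(\<Sum>i<n. d i * N ^ i) = (\<Sum>i<n. e i * N ^ i)" "i < n"
  shows "d i = e i"
  using assms
proof (induction n arbitrary: d e i)
  case (Suc n)
  have split: "(\<Sum>i<Suc n. u i * N ^ i) = u 0 + N * (\<Sum>i<n. u (Suc i) * N ^ i)"
    for u :: "nat \<Rightarrow> nat"
    unfolding sum.lessThan_Suc_shift by (simp add: sum_distrib_left mult_ac)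
  have eq: "d 0 + N * (\<Sum>i<n. d (Suc i) * N ^ i) = e 0 + N * (\<Sum>i<n. e (Suc i) * N ^ i)"
    using Suc.prems(3) unfolding split .
  have lt: "d 0 < N" "e 0 < N"
    using Suc.prems by auto
  have "d 0 = e 0"
    using arg_cong[OF eq, of "\<lambda>x. x mod N"] lt by simp
  moreover have "(\<Sum>i<n. d (Suc i) * N ^ i) = (\<Sum>i<n. e (Suc i) * N ^ i)"
    using arg_cong[OF eq, of "\<lambda>x. x div N"] lt by simp
  ultimately show ?case
    using Suc.IH[of "d \<circ> Suc" "e \<circ> Suc"] Suc.prems by (cases i) auto
qed simp

text \<open>The power of \<open>t\<close> that a monomial becomes under Kronecker's substitution.
  The numbering \<open>idx\<close> is needed because the type of variables carries no order.\<close>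

definition kronecker_weight :: "('n::finite \<Rightarrow> nat) \<Rightarrow> nat \<Rightarrow> ('n \<Rightarrow>\<^sub>0 nat) \<Rightarrow> nat" where
  "kronecker_weight idx N m = (\<Sum>j\<in>UNIV. Poly_Mapping.lookup m j * N ^ idx j)"

text \<open>Built monomial by monomial, so that coefficients can be read off;
  \<open>poly_kronecker\<close> identifies it with the substitution.\<close>

definition kronecker :: "('n::finite \<Rightarrow> nat) \<Rightarrow> nat \<Rightarrow> 'n cpoly \<Rightarrow> complex poly" where
  "kronecker idx N p =
     (\<Sum>m\<in>Poly_Mapping.keys p. monom (Poly_Mapping.lookup p m) (kronecker_weight idx N m))"

lemma poly_kronecker: "poly (kronecker idx N p) t = eval p (\<chi> j. t ^ (N ^ idx j))"
  by (simp add: kronecker_def eval_def poly_sum poly_monom kronecker_weight_def power_sum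
      mult.commute flip: power_mult)

text \<open>The weight is a number in base \<open>N\<close> whose digit at position
  \<open>idx j\<close> is the exponent of the variable \<open>j\<close>.\<close>

lemma kronecker_weight_inj:
  fixes idx :: "'n::finite \<Rightarrow> nat"
  assumes idx: "bij_betw idx UNIV {..<CARD('n)}"
    and bound: "\<And>j. Poly_Mapping.lookup m j < N" "\<And>j. Poly_Mapping.lookup m' j < N"
    and eq: "kronecker_weight idx N m = kronecker_weight idx N m'"
  shows "m = m'"
proof (rule poly_mapping_eqI)
  fix j
  \<comment> \<open>Reindexing along \<open>idx\<close> turns the sum over variables into one over
    digit positions.\<close>
  have weight: "kronecker_weight idx N u =
      (\<Sum>i<CARD('n). Poly_Mapping.lookup u (inv idx i) * N ^ i)" for u
    unfolding kronecker_weight_def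
    using sum.reindex_bij_betw[OF idx, of "\<lambda>i. Poly_Mapping.lookup u (inv idx i) * N ^ i"] idx
    by (simp add: bij_betw_def)
  have "Poly_Mapping.lookup m (inv idx (idx j)) = Poly_Mapping.lookup m' (inv idx (idx j))"
  proof (rule digits_unique[where n = "CARD('n)" and N = N
        and d = "\<lambda>i. Poly_Mapping.lookup m (inv idx i)"
        and e = "\<lambda>i. Poly_Mapping.lookup m' (inv idx i)"])
    show "(\<Sum>i<CARD('n). Poly_Mapping.lookup m (inv idx i) * N ^ i) =
        (\<Sum>i<CARD('n). Poly_Mapping.lookup m' (inv idx i) * N ^ i)"
      using eq by (simp add: weight)
    show "idx j < CARD('n)"
      using idx by (auto simp: bij_betw_def)
  qed (use bound in auto)
  then show "Poly_Mapping.lookup m j = Poly_Mapping.lookup m' j"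
    using idx by (simp add: bij_betw_def)
qed

text \<open>Distinct monomials of \<open>p\<close> go to distinct powers of \<open>t\<close>, so
  nothing cancels: each coefficient of \<open>p\<close> survives at the weight of its
  monomial.\<close>

lemma kronecker_nonzero:
  fixes idx :: "'n::finite \<Rightarrow> nat"
  assumes idx: "bij_betw idx UNIV {..<CARD('n)}"
    and bound: "\<And>m j. m \<in> Poly_Mapping.keys p \<Longrightarrow> Poly_Mapping.lookup m j < N"
    and "p \<noteq> 0"
  shows "kronecker idx N p \<noteq> 0"
proof -
  from \<open>p \<noteq> 0\<close> obtain m where m: "m \<in> Poly_Mapping.keys p"
    by (metis keys_eq_empty ex_in_conv)
  have "u = m" if "u \<in> Poly_Mapping.keys p" "kronecker_weight idx N u = kronecker_weight idx N m" for u
    using idx bound[OF that(1)] bound[OF m] that(2) by (rule kronecker_weight_inj)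
  then have "coeff (kronecker idx N p) (kronecker_weight idx N m) =
      (\<Sum>u\<in>Poly_Mapping.keys p. if u = m then Poly_Mapping.lookup p u else 0)"
    unfolding kronecker_def coeff_sum coeff_monom
    by (intro sum.cong) auto
  also have "\<dots> \<noteq> 0"
    using m by (simp add: in_keys_iff)
  finally show ?thesis
    by auto
qed

lemma exponents_bounded:
  fixes p :: "'n::finite cpoly"
  obtains N where "\<And>m j. m \<in> Poly_Mapping.keys p \<Longrightarrow> Poly_Mapping.lookup m j < N"
proof -
  let ?E = "(\<lambda>(m, j). Poly_Mapping.lookup m j) ` (Poly_Mapping.keys p \<times> UNIV)"
  \<comment> \<open>\<open>?E\<close> is finite, as there are finitely many monomials and variables.
    For \<open>p = 0\<close> it is empty and the bound is vacuous.\<close>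
  have "\<forall>e\<in>?E. e < Suc (Max ?E)"
    by (simp add: less_Suc_eq_le)
  then show thesis
    by (intro that[of "Suc (Max ?E)"]) auto
qed

lemma common_nonroot:
  fixes p q :: "'n::finite cpoly"
  assumes "p \<noteq> 0" "q \<noteq> 0"
  shows "\<exists>a. eval p a \<noteq> 0 \<and> eval q a \<noteq> 0"
proof -
  obtain idx :: "'n \<Rightarrow> nat" where idx: "bij_betw idx UNIV {..<CARD('n)}"
    using ex_bij_betw_finite_nat[of "UNIV :: 'n set"] by (auto simp: atLeast0LessThan)
  obtain M where M: "\<And>m j. m \<in> Poly_Mapping.keys p \<Longrightarrow> Poly_Mapping.lookup m j < M"
    using exponents_bounded[of p] by blast
  obtain N where N: "\<And>m j. m \<in> Poly_Mapping.keys q \<Longrightarrow> Poly_Mapping.lookup m j < N"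
    using exponents_bounded[of q] by blast
  \<comment> \<open>One base above the exponents of both polynomials, so that one value of
    \<open>t\<close> yields the same point for both.\<close>
  let ?K = "kronecker idx (max M N)"
  have "?K p \<noteq> 0"
    using M assms(1) by (intro kronecker_nonzero[OF idx]) (auto simp: less_max_iff_disj)
  moreover have "?K q \<noteq> 0"
    using N assms(2) by (intro kronecker_nonzero[OF idx]) (auto simp: less_max_iff_disj)
  ultimately have "?K p * ?K q \<noteq> 0"
    by simp
  \<comment> \<open>A nonzero univariate polynomial over an infinite field has a non-root.\<close>
  then obtain t where "poly (?K p * ?K q) t \<noteq> 0"
    using poly_all_0_iff_0 by blast
  then show ?thesis
    by (auto simp: poly_kronecker)
qed

lemma comp_word_Nil [simp]: "comp_word F [] = id"
  by (simp add: comp_word_def)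

lemma comp_word_snoc [simp]: "comp_word F (w @ [i]) = poly_map (F i) \<circ> comp_word F w"
  by (simp add: comp_word_def)

text \<open>Induction from the right end of the word: its last letter is the outermost map, which
  \<open>f\<close> absorbs.\<close>

lemma eval_comp_word:
  assumes "\<forall>i\<in>{1..k}. subst f (F i) = f" "set w \<subseteq> {1..k}"
  shows "eval f (comp_word F w a) = eval f a"
  using assms(2)
proof (induction w rule: rev_induct)
  case (snoc i w)
  then show ?case
    using assms(1) by (simp flip: eval_subst)
qed simp

theorem corollary5p4:
  fixes F :: "nat \<Rightarrow> 'n::finite cpoly ^ 'n" and k :: nat and h f :: "'n cpoly"
  assumes "h \<noteq> 0"
  shows "(\<forall>a :: complex ^ 'n. f - Const (eval f a) \<in> loop_invariants a h k F) \<longleftrightarrow>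
         (\<forall>i\<in>{1..k}. subst f (F i) = f)"
proof
  assume inv: "\<forall>a :: complex ^ 'n. f - Const (eval f a) \<in> loop_invariants a h k F"
  show "\<forall>i\<in>{1..k}. subst f (F i) = f"
  proof (rule ballI, rule ccontr)
    fix i assume i: "i \<in> {1..k}" and "subst f (F i) \<noteq> f"
    \<comment> \<open>At this point the loop is entered and its first step along \<open>F i\<close>
      changes the value of \<open>f\<close>.\<close>
    then obtain a where a: "eval h a \<noteq> 0" "eval (subst f (F i) - f) a \<noteq> 0"
      using common_nonroot[OF assms, of "subst f (F i) - f"] by auto
    have "f - Const (eval f a) \<in> loop_invariants a h k F" "set [i] \<subseteq> {1..k}"
      using inv i by simp_all
    then have "(\<forall>j\<in>{1..length [i]}. eval (f - Const (eval f a)) (comp_word F (take j [i]) a) = 0) \<or>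
        (\<exists>l<length [i]. eval h (comp_word F (take l [i]) a) = 0)"
      unfolding loop_invariants_def by blast
    \<comment> \<open>For a one-letter word the second alternative allows only \<open>l = 0\<close>,
      which would mean \<open>eval h a = 0\<close>.\<close>
    with a(1) have "eval (f - Const (eval f a)) (comp_word F [i] a) = 0"
      by auto
    with a(2) comp_word_snoc[of F "[]" i] show False
      by (simp add: eval_diff eval_subst)
  qed
next
  assume "\<forall>i\<in>{1..k}. subst f (F i) = f"
  \<comment> \<open>Prefixes of admissible words are admissible, so the first alternative of the
    definition holds for every word.\<close>
  then have "eval f (comp_word F (take j w) a) = eval f a" if "set w \<subseteq> {1..k}" for j w a
    using eval_comp_word that set_take_subset by (metis subset_trans)
  then show "\<forall>a :: complex ^ 'n. f - Const (eval f a) \<in> loop_invariants a h k F"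
    by (simp add: loop_invariants_def eval_diff)
qed

end
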